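(* Let $(\Gamma,I)$ be a finite quiver without loops. For any $\nu\in P$ one has $$s(\nu)=s\cdot S_\nu\overline{s}$$ in $R=\mathbb Q(q)[[x_i,y_i\mid i\in I]]$.
   Context: Lattices. $C$ is the symmetric generalized Cartan matrix of $\Gamma$ ($C_{ii}=2$, $-C_{ij}$ = number of arrows joining $i$ and $j$ in either direction for $i\ne j$), $\mathfrak g(\Gamma)$ the Kac-Moody algebra with Cartan subalgebra $\mathfrak h$, $\alpha_i$ ($i\in I$) the simple roots, $(-,-)$ the standard nondegenerate symmetric bilinear form on $\mathfrak h^\vee$ (so $(\alpha_i,\alpha_j)=C_{ij}$). $Q=\bigoplus_i\mathbb Z\alpha_i$, $Q_+=\bigoplus_i\mathbb N\alpha_i$ with $\mathbb N=\mathbb Z_{\ge0}$; write $\alpha=\sum_i\alpha^i\alpha_i$ and identify $Q$ with $\mathbb Z^I$. $P$ is the weight lattice; for $\nu\in P$ put $\nu_i=(\nu,\alpha_i)\in\mathbb Z$. Elements of $Q$ are also regarded as elements of $P$. So $(\nu,\alpha)=\sum_i\nu_i\alpha^i$ for $\nu\in P$, $\alpha\in Q$. $T(\alpha)=\frac12(\alpha,\alpha)$. $x^\alpha=\prod_ix_i^{\alpha^i}$, $y^\alpha=\prod_iy_i^{\alpha^i}$. $q$-binomials. For $n\in\mathbb Z$, $m\in\mathbb N$: $[n,m]=\prod_{k=1}^m\frac{1-q^{n+k}}{1-q^k}$, $[\infty,m]=\prod_{k=1}^m\frac1{1-q^k}$ in $\mathbb Q(q)$. For $\nu\in P,\alpha\in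 Q_+$: $[\nu,\alpha]=\prod_i[\nu_i,\alpha^i]$, $[\infty,\alpha]=\prod_i[\infty,\alpha^i]$. Partitions. $\mathcal P$ is the set of partitions $(\tau_1\ge\tau_2\ge\dots\ge0)$, eventually zero. For $\tau=(\tau^i)_{i\in I}\in\mathcal P^I$ put $\tau_k=(\tau^i_k)_{i\in I}\in\mathbb N^I=Q_+$ and $|\tau|=\sum_{k\ge1}\tau_k$. Series. In $R$ define $$s(\nu)=\sum_{\tau\in\mathcal P^I}x^{|\tau|}y^{\tau_1}\prod_{k\ge1}q^{T(\tau_k)}\Big[\nu-\sum_{l=1}^k\tau_l,\ \tau_k-\tau_{k+1}\Big],\qquad s=\sum_{\tau\in\mathcal P^I}x^{|\tau|}y^{\tau_1}\prod_{k\ge1}q^{T(\tau_k)}[\infty,\tau_k-\tau_{k+1}].$$ The bar denotes the conjugation $q\mapsto q^{-1}$ on coefficients (fixing all $x_i,y_i$). For $\nu\in P$, $S_\nu:R\to R$ is the ring homomorphism $\sum_\alpha f_\alpha y^\alpha\mapsto\sum_\alpha q^{(\nu,\alpha)}f_\alpha y^\alpha$, where $f_\alpha\in\mathbb Q(q)[[x_i\mid i\in I]]$. *)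

theory Defs
  imports
    "HOL-Analysis.Analysis"
    "HOL-Computational_Algebra.Computational_Algebra"
    "HOL-Library.Groups_Big_Fun"
    "Graph_Theory.Digraph"
begin

section \<open>Multivariate formal power series\<close>

text \<open>
  Formal power series in finitely many variables \<open>'v\<close>, as functions from exponent vectors to
  coefficients.
\<close>

typedef (overloaded) ('v, 'a) mps = "UNIV :: (('v \<Rightarrow> nat) \<Rightarrow> 'a) set"
  morphisms mps_coeff Abs_mps ..

setup_lifting type_definition_mps

lemma mps_eqI: "(\<And>m. mps_coeff f m = mps_coeff g m) \<Longrightarrow> f = g"
  by transfer auto

definition exponent_splits :: "('v \<Rightarrow> nat) \<Rightarrow> (('v \<Rightarrow> nat) \<times> ('v \<Rightarrow> nat)) set" where
  "exponent_splits m = {(a, b). \<forall>v. a v + b v = m v}"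

lemma finite_exponents_le: "finite {a. \<forall>v. a v \<le> m v}" for m :: "'v::finite \<Rightarrow> nat"
proof -
  have "{a. \<forall>v. a v \<le> m v} = (\<Pi>\<^sub>E v\<in>UNIV. {..m v})"
    by (auto simp: PiE_def Pi_def)
  then show ?thesis
    by (simp add: finite_PiE)
qed

lemma finite_exponent_splits [simp]: "finite (exponent_splits m)" for m :: "'v::finite \<Rightarrow> nat"
proof (rule finite_subset)
  show "exponent_splits m \<subseteq> {a. \<forall>v. a v \<le> m v} \<times> {a. \<forall>v. a v \<le> m v}"
    by (auto simp: exponent_splits_def) (metis le_add1 le_add2)+
qed (simp add: finite_exponents_le)

instantiation mps :: (finite, comm_ring_1) comm_ring_1
begin

lift_definition zero_mps :: "('a, 'b) mps" is "\<lambda>_. 0" .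

lift_definition one_mps :: "('a, 'b) mps" is "\<lambda>m. if m = (\<lambda>_. 0) then 1 else 0" .

lift_definition plus_mps :: "('a, 'b) mps \<Rightarrow> ('a, 'b) mps \<Rightarrow> ('a, 'b) mps"
  is "\<lambda>f g m. f m + g m" .

lift_definition minus_mps :: "('a, 'b) mps \<Rightarrow> ('a, 'b) mps \<Rightarrow> ('a, 'b) mps"
  is "\<lambda>f g m. f m - g m" .

lift_definition uminus_mps :: "('a, 'b) mps \<Rightarrow> ('a, 'b) mps"
  is "\<lambda>f m. - f m" .

lift_definition times_mps :: "('a, 'b) mps \<Rightarrow> ('a, 'b) mps \<Rightarrow> ('a, 'b) mps"
  is "\<lambda>f g m. \<Sum>(a, b)\<in>exponent_splits m. f a * g b" .

instance
proof
  fix f g h :: "('a, 'b) mps"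
  show "f + g + h = f + (g + h)" "f + g = g + f" "0 + f = f" "- f + f = 0" "f - g = f + - g"
    by (transfer; simp add: fun_eq_iff algebra_simps)+
  show "f * g = g * f"
  proof (transfer, rule ext)
    fix f g :: "('a \<Rightarrow> nat) \<Rightarrow> 'b" and m
    show "(\<Sum>(a, b)\<in>exponent_splits m. f a * g b) = (\<Sum>(a, b)\<in>exponent_splits m. g a * f b)"
      by (rule sum.reindex_bij_witness[of _ prod.swap prod.swap])
        (auto simp: exponent_splits_def algebra_simps)
  qed
  show "(f + g) * h = f * h + g * h"
    by (transfer; auto simp: fun_eq_iff case_prod_unfold sum.distrib algebra_simps)
  show "1 * f = f"
  proof (transfer, rule ext)
    fix f :: "('a \<Rightarrow> nat) \<Rightarrow> 'b" and m
    have "(\<Sum>(a, b)\<in>exponent_splits m. (if a = (\<lambda>_. 0) then 1 else 0) * f b) =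
      (\<Sum>(a, b)\<in>{(\<lambda>_ :: 'a. 0 :: nat, m)}. (if a = (\<lambda>_. 0) then 1 else 0) * f b)"
      by (rule sum.mono_neutral_right[OF finite_exponent_splits])
        (auto simp: exponent_splits_def fun_eq_iff split: if_splits)
    then show "(\<Sum>(a, b)\<in>exponent_splits m. (if a = (\<lambda>_. 0) then 1 else 0) * f b) = f m"
      by simp
  qed
  show "f * g * h = f * (g * h)"
  proof (transfer, rule ext)
    fix f g h :: "('a \<Rightarrow> nat) \<Rightarrow> 'b" and m
    have "(\<Sum>(a, b)\<in>exponent_splits m. (\<Sum>(c, d)\<in>exponent_splits a. f c * g d) * h b) =
      (\<Sum>x\<in>exponent_splits m. \<Sum>y\<in>exponent_splits (fst x).
         f (fst y) * g (snd y) * h (snd x))"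
      by (simp add: case_prod_unfold sum_distrib_right)
    also have "\<dots> = (\<Sum>z\<in>(SIGMA x:exponent_splits m. exponent_splits (fst x)).
         f (fst (snd z)) * g (snd (snd z)) * h (snd (fst z)))"
      by (subst sum.Sigma) (auto simp: case_prod_unfold)
    also have "\<dots> = (\<Sum>z\<in>(SIGMA x:exponent_splits m. exponent_splits (snd x)).
         f (fst (fst z)) * (g (fst (snd z)) * h (snd (snd z))))"
      by (rule sum.reindex_bij_witness[of _
            "\<lambda>((a, _), (c, d)). ((\<lambda>v. a v + c v, d), (a, c))"
            "\<lambda>((_, b), (c, d)). ((c, \<lambda>v. d v + b v), (d, b))"])
        (auto simp: exponent_splits_def fun_eq_iff algebra_simps)
    also have "\<dots> = (\<Sum>x\<in>exponent_splits m. \<Sum>y\<in>exponent_splits (snd x).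
         f (fst x) * (g (fst y) * h (snd y)))"
      by (subst sum.Sigma) (auto simp: case_prod_unfold)
    also have "\<dots> = (\<Sum>(a, b)\<in>exponent_splits m. f a * (\<Sum>(c, d)\<in>exponent_splits b. g c * h d))"
      by (simp add: case_prod_unfold sum_distrib_left)
    finally show "(\<Sum>(a, b)\<in>exponent_splits m. (\<Sum>(c, d)\<in>exponent_splits a. f c * g d) * h b) =
      (\<Sum>(a, b)\<in>exponent_splits m. f a * (\<Sum>(c, d)\<in>exponent_splits b. g c * h d))" .
  qed
  show "(0 :: ('a, 'b) mps) \<noteq> 1"
    by transfer (auto simp: fun_eq_iff)
qed

end

lift_definition mps_monom :: "'a \<Rightarrow> ('v \<Rightarrow> nat) \<Rightarrow> ('v, 'a::zero) mps"
  is "\<lambda>c m n. if n = m then c else 0" .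

lift_definition mps_map :: "('a \<Rightarrow> 'b) \<Rightarrow> ('v, 'a) mps \<Rightarrow> ('v, 'b) mps"
  is "\<lambda>\<phi> f m. \<phi> (f m)" .

text \<open>
  Sum of a family of power series indexed by \<open>A\<close>, only meaningful if the family is summable,
  i.e. every coefficient is nonzero in only finitely many members.
\<close>

definition mps_summable :: "('t \<Rightarrow> ('v, 'a::comm_monoid_add) mps) \<Rightarrow> 't set \<Rightarrow> bool" where
  "mps_summable F A \<longleftrightarrow> (\<forall>m. finite {t\<in>A. mps_coeff (F t) m \<noteq> 0})"

lift_definition mps_sum :: "('t \<Rightarrow> ('v, 'a::comm_monoid_add) mps) \<Rightarrow> 't set \<Rightarrow> ('v, 'a) mps"
  is "\<lambda>F A m. \<Sum>t\<in>{t\<in>A. F t m \<noteq> 0}. F t m" .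


section \<open>The field \<open>\<rat>(q)\<close>\<close>

type_synonym ratq = "rat poly fract"

definition qvar :: ratq where
  "qvar = to_fract [:0, 1:]"

definition eval_qinv :: "rat poly \<Rightarrow> ratq" where
  "eval_qinv p = poly (map_poly (\<lambda>c. to_fract [:c:]) p) (inverse qvar)"

definition qbinom :: "int \<Rightarrow> nat \<Rightarrow> ratq" where
  "qbinom n m = (\<Prod>k=1..m. (1 - qvar powi (n + int k)) / (1 - qvar ^ k))"

definition qbinom_inf :: "nat \<Rightarrow> ratq" where
  "qbinom_inf m = (\<Prod>k=1..m. 1 / (1 - qvar ^ k))"

lemma qvar_nonzero [simp]: "qvar \<noteq> 0"
  by (simp add: qvar_def)

lemma eval_qinv_0 [simp]: "eval_qinv 0 = 0"
  by (simp add: eval_qinv_def)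

lemma eval_qinv_pCons [simp]: "eval_qinv (pCons c p) = to_fract [:c:] + inverse qvar * eval_qinv p"
  by (simp add: eval_qinv_def map_poly_pCons)

lemma to_fract_const_add: "to_fract [:a + b:] = to_fract [:a:] + to_fract [:b::rat:]"
  by (simp flip: to_fract_add)

lemma eval_qinv_add: "eval_qinv (a + b) = eval_qinv a + eval_qinv b"
  by (induction a b rule: poly_induct2) (simp_all add: to_fract_const_add algebra_simps)

lemma eval_qinv_smult: "eval_qinv (smult c a) = to_fract [:c:] * eval_qinv a"
proof (induction a)
  case (pCons d a)
  have "to_fract [:c * d:] = to_fract [:c:] * to_fract [:d:]"
    by (simp flip: to_fract_mult)
  with pCons show ?case by (simp add: algebra_simps)
qed simp

lemma eval_qinv_mult: "eval_qinv (a * b) = eval_qinv a * eval_qinv b"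
  by (induction a) (simp_all add: eval_qinv_add eval_qinv_smult algebra_simps)

lemma poly_map_to_fract_qvar: "poly (map_poly (\<lambda>c. to_fract [:c:]) p) qvar = to_fract p"
proof (induction p)
  case (pCons c p)
  have "to_fract (pCons c p) = to_fract ([:c:] + [:0, 1:] * p)"
    by simp
  also have "\<dots> = to_fract [:c:] + qvar * to_fract p"
    by (simp only: qvar_def to_fract_add to_fract_mult)
  finally show ?case using pCons by (simp add: map_poly_pCons)
qed simp

lemma eval_qinv_nonzero:
  assumes "p \<noteq> 0"
  shows "eval_qinv p \<noteq> 0"
proof -
  let ?E = "map_poly (\<lambda>c. to_fract [:c:] :: ratq)"
  have deg: "degree (?E p) = degree p"
    by (rule degree_map_poly) simp
  have refl: "reflect_poly (?E p) = ?E (reflect_poly p)"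
    by (rule poly_eqI) (simp add: coeff_reflect_poly coeff_map_poly deg)
  have "qvar ^ degree p * eval_qinv p = poly (reflect_poly (?E p)) qvar"
    by (simp add: eval_qinv_def poly_reflect_poly_nz deg)
  also have "\<dots> = to_fract (reflect_poly p)"
    by (simp only: refl poly_map_to_fract_qvar)
  also have "\<dots> \<noteq> 0"
    using assms by simp
  finally show ?thesis by auto
qed

text \<open>The conjugation \<open>q \<mapsto> q\<inverse>\<close>; the choice of the fraction does not matter by \<open>qconj_Fract\<close>.\<close>

definition qconj :: "ratq \<Rightarrow> ratq" where
  "qconj f = (THE r. \<exists>a b. b \<noteq> 0 \<and> f = Fraction_Field.Fract a b \<and> r = eval_qinv a / eval_qinv b)"

lemma qconj_Fract:
  assumes "b \<noteq> 0"
  shows "qconj (Fraction_Field.Fract a b) = eval_qinv a / eval_qinv b"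
  unfolding qconj_def
proof (rule the_equality)
  fix r
  assume "\<exists>c d. d \<noteq> 0 \<and> Fraction_Field.Fract a b = Fraction_Field.Fract c d \<and>
            r = eval_qinv c / eval_qinv d"
  then obtain c d where d: "d \<noteq> 0" and eq: "Fraction_Field.Fract a b = Fraction_Field.Fract c d"
    and r: "r = eval_qinv c / eval_qinv d"
    by blast
  have "c * b = a * d"
    using eq assms d by (simp add: eq_fract)
  then have "eval_qinv c * eval_qinv b = eval_qinv a * eval_qinv d"
    by (simp flip: eval_qinv_mult)
  then show "r = eval_qinv a / eval_qinv b"
    using eval_qinv_nonzero[OF assms] eval_qinv_nonzero[OF d] by (simp add: r frac_eq_eq)
qed (use assms in blast)

lemma qconj_to_fract [simp]: "qconj (to_fract a) = eval_qinv a"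
proof -
  have "eval_qinv 1 = 1"
    by (simp add: one_pCons flip: to_fract_1)
  then show ?thesis
    by (simp add: to_fract_def qconj_Fract)
qed

lemma qconj_qvar: "qconj qvar = inverse qvar"
proof -
  have "to_fract [:1::rat:] = 1"
    by (simp flip: one_pCons)
  then show ?thesis
    by (simp add: qvar_def)
qed

lemma qconj_add: "qconj (f + g) = qconj f + qconj g"
  by (cases f, cases g) (simp add: qconj_Fract eval_qinv_add eval_qinv_mult eval_qinv_nonzero
      add_frac_eq)

lemma qconj_mult: "qconj (f * g) = qconj f * qconj g"
  by (cases f, cases g) (simp add: qconj_Fract eval_qinv_mult)


section \<open>Quivers, realizations and weights\<close>

definition cartan_matrix :: "('i, 'e) pre_digraph \<Rightarrow> 'i \<Rightarrow> 'i \<Rightarrow> int" where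
  "cartan_matrix \<Gamma> i j =
     (if i = j then 2
      else - int (card {e \<in> arcs \<Gamma>. (tail \<Gamma> e = i \<and> head \<Gamma> e = j) \<or> (tail \<Gamma> e = j \<and> head \<Gamma> e = i)}))"

text \<open>The integer equal to \<open>z\<close>; only used where \<open>z\<close> is one.\<close>

definition the_int :: "complex \<Rightarrow> int" where
  "the_int z = (THE n. z = of_int n)"

lemma the_int_of_int [simp]: "the_int (of_int n) = n"
  by (simp add: the_int_def)

text \<open>
  The type \<open>'h\<close> (with scalar multiplication \<open>cscale\<close>) is the dual \<open>\<hh>\<^sup>\<or>\<close> of the Cartan subalgebra of the
  Kac-Moody algebra of the symmetric matrix \<open>C\<close>, \<open>\<alpha> i\<close> are the simple roots and \<open>form\<close> is the standard
  form. The axioms characterise these data up to isomorphism: by the dimension axiom, the span of the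
  \<open>\<alpha> i\<close> has an isotropic complement, dual to the radical of \<open>form\<close> on that span.
  Infinite-dimensional spaces have \<open>dim UNIV = 0\<close> and are excluded by the dimension axiom.
\<close>

locale realization = vector_space cscale
  for cscale :: "complex \<Rightarrow> 'h::ab_group_add \<Rightarrow> 'h" +
  fixes C :: "'i::finite \<Rightarrow> 'i \<Rightarrow> int"
    and form :: "'h \<Rightarrow> 'h \<Rightarrow> complex"
    and \<alpha> :: "'i \<Rightarrow> 'h"
  assumes dim_realization: "dim UNIV + rank (\<chi> i j. complex_of_int (C i j)) = 2 * CARD('i)"
    and inj_simple_roots: "inj \<alpha>"
    and independent_simple_roots: "independent (range \<alpha>)"
    and form_linear: "Vector_Spaces.linear cscale (*) (form v)"
    and form_sym: "form v w = form w v"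
    and form_nondegenerate: "(\<And>w. form v w = 0) \<Longrightarrow> v = 0"
    and form_simple_roots: "form (\<alpha> i) (\<alpha> j) = of_int (C i j)"

text \<open>
  The element \<open>\<Sum>\<^sub>i a\<^sup>i \<alpha>\<^sub>i\<close> of \<open>Q\<^sub>+ = \<nat>\<^sup>I\<close>, regarded as an element of \<open>\<hh>\<^sup>\<or>\<close>.
\<close>

definition root_vec :: "(complex \<Rightarrow> 'h::ab_group_add \<Rightarrow> 'h) \<Rightarrow> ('i::finite \<Rightarrow> 'h) \<Rightarrow> ('i \<Rightarrow> nat) \<Rightarrow> 'h" where
  "root_vec cscale \<alpha> a = (\<Sum>i\<in>UNIV. cscale (of_nat (a i)) (\<alpha> i))"

definition weight_lattice :: "('h \<Rightarrow> 'h \<Rightarrow> complex) \<Rightarrow> ('i \<Rightarrow> 'h) \<Rightarrow> 'h set" where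
  "weight_lattice form \<alpha> = {\<nu>. \<forall>i. form \<nu> (\<alpha> i) \<in> \<int>}"

definition weight_comp :: "('h \<Rightarrow> 'h \<Rightarrow> complex) \<Rightarrow> ('i \<Rightarrow> 'h) \<Rightarrow> 'h \<Rightarrow> 'i \<Rightarrow> int" where
  "weight_comp form \<alpha> \<nu> i = the_int (form \<nu> (\<alpha> i))"

definition weight_pairing ::
    "(complex \<Rightarrow> 'h::ab_group_add \<Rightarrow> 'h) \<Rightarrow> ('h \<Rightarrow> 'h \<Rightarrow> complex) \<Rightarrow> ('i::finite \<Rightarrow> 'h) \<Rightarrow> 'h \<Rightarrow> ('i \<Rightarrow> nat) \<Rightarrow> int" where
  "weight_pairing cscale form \<alpha> \<nu> a = the_int (form \<nu> (root_vec cscale \<alpha> a))"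

definition tits_form ::
    "(complex \<Rightarrow> 'h::ab_group_add \<Rightarrow> 'h) \<Rightarrow> ('h \<Rightarrow> 'h \<Rightarrow> complex) \<Rightarrow> ('i::finite \<Rightarrow> 'h) \<Rightarrow> ('i \<Rightarrow> nat) \<Rightarrow> int" where
  "tits_form cscale form \<alpha> a = the_int (form (root_vec cscale \<alpha> a) (root_vec cscale \<alpha> a) / 2)"

context realization
begin

lemma form_root_vec: "form \<nu> (root_vec cscale \<alpha> a) = (\<Sum>i\<in>UNIV. form \<nu> (\<alpha> i) * of_nat (a i))"
proof -
  interpret l: Vector_Spaces.linear cscale "(*)" "form \<nu>"
    by (rule form_linear)
  show ?thesis
    by (simp add: root_vec_def l.sum l.scale mult.commute)
qed

lemma form_root_vec_root_vec:
  "form (root_vec cscale \<alpha> a) (root_vec cscale \<alpha> b) =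
     of_int (\<Sum>i\<in>UNIV. \<Sum>j\<in>UNIV. C i j * int (a i) * int (b j))"
proof -
  have "form (root_vec cscale \<alpha> a) (root_vec cscale \<alpha> b) =
    (\<Sum>j\<in>UNIV. (\<Sum>i\<in>UNIV. of_int (C j i) * of_nat (a i)) * of_nat (b j))"
    unfolding form_root_vec
    by (simp add: form_sym[of "root_vec cscale \<alpha> a"] form_root_vec form_simple_roots)
  also have "\<dots> = (\<Sum>j\<in>UNIV. \<Sum>i\<in>UNIV. of_int (C i j * int (a i) * int (b j)))"
  proof -
    have "C j i = C i j" for i j
      using form_sym[of "\<alpha> i" "\<alpha> j"] by (simp add: form_simple_roots)
    then show ?thesis by (simp add: sum_distrib_right)
  qed
  also have "\<dots> = (\<Sum>i\<in>UNIV. \<Sum>j\<in>UNIV. of_int (C i j * int (a i) * int (b j)))"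
    by (rule sum.swap)
  finally show ?thesis by simp
qed

lemma weight_comp_eq:
  assumes "\<nu> \<in> weight_lattice form \<alpha>"
  shows "of_int (weight_comp form \<alpha> \<nu> i) = form \<nu> (\<alpha> i)"
proof -
  from assms obtain n where "form \<nu> (\<alpha> i) = of_int n"
    by (auto simp: weight_lattice_def elim: Ints_cases)
  then show ?thesis by (simp add: weight_comp_def)
qed

lemma weight_pairing_eq:
  assumes "\<nu> \<in> weight_lattice form \<alpha>"
  shows "weight_pairing cscale form \<alpha> \<nu> a = (\<Sum>i\<in>UNIV. weight_comp form \<alpha> \<nu> i * int (a i))"
proof -
  have "form \<nu> (root_vec cscale \<alpha> a) = of_int (\<Sum>i\<in>UNIV. weight_comp form \<alpha> \<nu> i * int (a i))"
    by (simp add: form_root_vec weight_comp_eq[OF assms])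
  then show ?thesis by (simp only: weight_pairing_def the_int_of_int)
qed

lemma root_vec_in_weight_lattice: "root_vec cscale \<alpha> a \<in> weight_lattice form \<alpha>"
proof -
  have "form (root_vec cscale \<alpha> a) (\<alpha> i) = of_int (\<Sum>j\<in>UNIV. C i j * int (a j))" for i
    by (simp add: form_sym[of "root_vec cscale \<alpha> a"] form_root_vec form_simple_roots)
  then show ?thesis
    by (simp only: weight_lattice_def mem_Collect_eq Ints_of_int) simp
qed

lemma tits_form_eq:
  assumes "\<And>i. C i i = 2"
  shows "2 * tits_form cscale form \<alpha> a = (\<Sum>i\<in>UNIV. \<Sum>j\<in>UNIV. C i j * int (a i) * int (a j))"
    (is "_ = ?S")
proof -
  let ?f = "\<lambda>i j. C i j * int (a i) * int (a j)"
  have sym: "?f i j = ?f j i" for i j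
    using form_sym[of "\<alpha> i" "\<alpha> j"] by (simp add: form_simple_roots)
  have even: "even (\<Sum>i\<in>A. \<Sum>j\<in>A. ?f i j)" if "finite A" for A
    using that
  proof (induction A)
    case (insert x A)
    have "(\<Sum>i\<in>insert x A. \<Sum>j\<in>insert x A. ?f i j) =
      ?f x x + 2 * (\<Sum>j\<in>A. ?f x j) + (\<Sum>i\<in>A. \<Sum>j\<in>A. ?f i j)"
    proof -
      have "(\<Sum>i\<in>A. ?f i x) = (\<Sum>j\<in>A. ?f x j)"
        by (rule sum.cong[OF refl]) (rule sym)
      then show ?thesis
        using insert.hyps by (simp add: sum.distrib)
    qed
    then show ?case using insert.IH by (simp add: assms)
  qed simp
  obtain n where n: "?S = 2 * n"
    using even[OF finite] by (rule evenE)
  have "form (root_vec cscale \<alpha> a) (root_vec cscale \<alpha> a) / 2 = of_int n"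
    unfolding form_root_vec_root_vec n by simp
  then show ?thesis
    unfolding tits_form_def n by simp
qed

end


section \<open>Families of partitions and the series\<close>

text \<open>
  A family \<open>\<tau> \<in> \<P>\<^sup>I\<close> is given by its parts \<open>\<tau> i k\<close>, indexed from \<open>k = 0\<close>: the part \<open>\<tau>\<^sup>i\<^sub>k\<close> of the
  usual convention, \<open>k \<ge> 1\<close>, is \<open>\<tau> i (k - 1)\<close>. All products and sums over \<open>k\<close> below are shifted
  accordingly.
\<close>

definition partition_families :: "('i \<Rightarrow> nat \<Rightarrow> nat) set" where
  "partition_families = {\<tau>. \<forall>i. decseq (\<tau> i) \<and> finite {k. \<tau> i k \<noteq> 0}}"

definition part_vec :: "('i \<Rightarrow> nat \<Rightarrow> nat) \<Rightarrow> nat \<Rightarrow> 'i \<Rightarrow> nat" where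
  "part_vec \<tau> k = (\<lambda>i. \<tau> i k)"

definition size_vec :: "('i \<Rightarrow> nat \<Rightarrow> nat) \<Rightarrow> 'i \<Rightarrow> nat" where
  "size_vec \<tau> = (\<lambda>i. Sum_any (\<lambda>k. part_vec \<tau> k i))"

definition step_vec :: "('i \<Rightarrow> nat \<Rightarrow> nat) \<Rightarrow> nat \<Rightarrow> 'i \<Rightarrow> nat" where
  "step_vec \<tau> k = (\<lambda>i. part_vec \<tau> k i - part_vec \<tau> (Suc k) i)"

definition qbinom_wt :: "('h \<Rightarrow> 'h \<Rightarrow> complex) \<Rightarrow> ('i::finite \<Rightarrow> 'h) \<Rightarrow> 'h \<Rightarrow> ('i \<Rightarrow> nat) \<Rightarrow> ratq" where
  "qbinom_wt form \<alpha> \<nu> a = (\<Prod>i\<in>UNIV. qbinom (weight_comp form \<alpha> \<nu> i) (a i))"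

definition qbinom_inf_wt :: "('i::finite \<Rightarrow> nat) \<Rightarrow> ratq" where
  "qbinom_inf_wt a = (\<Prod>i\<in>UNIV. qbinom_inf (a i))"

text \<open>
  In the ring \<open>\<rat>(q)[[x\<^sub>i, y\<^sub>i]]\<close> the variable \<open>x\<^sub>i\<close> is \<open>Inl i\<close> and \<open>y\<^sub>i\<close> is \<open>Inr i\<close>, so
  \<open>mps_monom c (case_sum a b)\<close> is \<open>c x\<^sup>a y\<^sup>b\<close>.
\<close>

type_synonym 'i xy_series = "('i + 'i, ratq) mps"

definition s_wt ::
    "(complex \<Rightarrow> 'h::ab_group_add \<Rightarrow> 'h) \<Rightarrow> ('h \<Rightarrow> 'h \<Rightarrow> complex) \<Rightarrow> ('i::finite \<Rightarrow> 'h) \<Rightarrow> 'h \<Rightarrow> 'i xy_series" where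
  "s_wt cscale form \<alpha> \<nu> =
     mps_sum (\<lambda>\<tau>. mps_monom
         (Prod_any (\<lambda>k. qvar powi tits_form cscale form \<alpha> (part_vec \<tau> k) *
            qbinom_wt form \<alpha> (\<nu> - (\<Sum>l\<le>k. root_vec cscale \<alpha> (part_vec \<tau> l))) (step_vec \<tau> k)))
         (case_sum (size_vec \<tau>) (part_vec \<tau> 0)))
       partition_families"

definition s_inf ::
    "(complex \<Rightarrow> 'h::ab_group_add \<Rightarrow> 'h) \<Rightarrow> ('h \<Rightarrow> 'h \<Rightarrow> complex) \<Rightarrow> ('i::finite \<Rightarrow> 'h) \<Rightarrow> 'i xy_series" where
  "s_inf cscale form \<alpha> =
     mps_sum (\<lambda>\<tau>. mps_monom
         (Prod_any (\<lambda>k. qvar powi tits_form cscale form \<alpha> (part_vec \<tau> k) *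
            qbinom_inf_wt (step_vec \<tau> k)))
         (case_sum (size_vec \<tau>) (part_vec \<tau> 0)))
       partition_families"

definition series_conj :: "'i xy_series \<Rightarrow> 'i xy_series" where
  "series_conj f = mps_map qconj f"

definition shift_hom ::
    "(complex \<Rightarrow> 'h::ab_group_add \<Rightarrow> 'h) \<Rightarrow> ('h \<Rightarrow> 'h \<Rightarrow> complex) \<Rightarrow> ('i::finite \<Rightarrow> 'h) \<Rightarrow> 'h \<Rightarrow>
       'i xy_series \<Rightarrow> 'i xy_series" where
  "shift_hom cscale form \<alpha> \<nu> f =
     Abs_mps (\<lambda>m. qvar powi weight_pairing cscale form \<alpha> \<nu> (m \<circ> Inr) * mps_coeff f m)"

lemma finite_fibre_partition_families:
  "finite {\<tau> \<in> partition_families. size_vec \<tau> = a}" for a :: "'i::finite \<Rightarrow> nat"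
proof -
  let ?N = "Max (range a)"
  have bound: "\<tau> i k \<le> ?N \<and> (k > ?N \<longrightarrow> \<tau> i k = 0)"
    if \<tau>: "\<tau> \<in> partition_families" "size_vec \<tau> = a" for \<tau> i k
  proof -
    have dec: "decseq (\<tau> i)" and fin: "finite {k. \<tau> i k \<noteq> 0}"
      using \<tau> by (auto simp: partition_families_def)
    have "a i = Sum_any (\<tau> i)"
      using \<tau>(2) by (auto simp: size_vec_def part_vec_def)
    then have ai: "a i = (\<Sum>k | \<tau> i k \<noteq> 0. \<tau> i k)"
      by (simp add: Sum_any.expand_set)
    have aN: "a i \<le> ?N" by simp
    have "\<tau> i k \<le> ?N"
    proof (cases "\<tau> i k = 0")
      case False
      then have "\<tau> i k \<le> a i"
        unfolding ai using fin by (intro member_le_sum) auto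
      then show ?thesis using aN by (rule order_trans)
    qed simp
    moreover have "\<tau> i k = 0" if k: "k > ?N"
    proof (rule ccontr)
      assume nz: "\<tau> i k \<noteq> 0"
      then have pos: "\<tau> i l \<ge> 1" if "l \<le> k" for l
        using decseqD[OF dec that] by linarith
      then have "{..k} \<subseteq> {k. \<tau> i k \<noteq> 0}" by force
      then have "Suc k \<le> card {k. \<tau> i k \<noteq> 0}"
        using card_mono[OF fin, of "{..k}"] by simp
      also have "\<dots> = (\<Sum>k | \<tau> i k \<noteq> 0. 1)" by simp
      also have "\<dots> \<le> a i"
        unfolding ai by (rule sum_mono) auto
      finally show False using aN k by linarith
    qed
    ultimately show ?thesis by blast
  qed
  have "finite {f :: nat \<Rightarrow> nat. \<forall>k. (k \<in> {..?N} \<longrightarrow> f k \<in> {..?N}) \<and> (k \<notin> {..?N} \<longrightarrow> f k = 0)}"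
    by (rule finite_set_of_finite_funs) auto
  then have "finite (\<Pi>\<^sub>E i\<in>(UNIV :: 'i set).
     {f :: nat \<Rightarrow> nat. \<forall>k. (k \<in> {..?N} \<longrightarrow> f k \<in> {..?N}) \<and> (k \<notin> {..?N} \<longrightarrow> f k = 0)})"
    by (intro finite_PiE) auto
  then show ?thesis
  proof (rule finite_subset[rotated], intro subsetI)
    fix \<tau>
    assume "\<tau> \<in> {\<tau> \<in> partition_families. size_vec \<tau> = a}"
    then have "\<tau> i k \<le> ?N" "k > ?N \<Longrightarrow> \<tau> i k = 0" for i k
      using bound[of \<tau> i k] by blast+
    then show "\<tau> \<in> (\<Pi>\<^sub>E i\<in>(UNIV :: 'i set).
     {f :: nat \<Rightarrow> nat. \<forall>k. (k \<in> {..?N} \<longrightarrow> f k \<in> {..?N}) \<and> (k \<notin> {..?N} \<longrightarrow> f k = 0)})"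
      unfolding PiE_def Pi_def extensional_def atMost_iff by (simp add: not_le del: Max_less_iff Max_ge_iff)
  qed
qed

text \<open>The families defining \<open>s_wt\<close> and \<open>s_inf\<close> are summable, and their infinite products are finite.\<close>

lemma mps_summable_partition_families:
  "mps_summable (\<lambda>\<tau>. mps_monom (c \<tau>) (case_sum (size_vec \<tau>) (part_vec \<tau> 0)))
     (partition_families :: ('i::finite \<Rightarrow> nat \<Rightarrow> nat) set)"
  unfolding mps_summable_def
proof
  fix m :: "'i + 'i \<Rightarrow> nat"
  show "finite {\<tau> \<in> partition_families.
      mps_coeff (mps_monom (c \<tau>) (case_sum (size_vec \<tau>) (part_vec \<tau> 0))) m \<noteq> 0}"
    by (rule finite_subset[OF _ finite_fibre_partition_families[of "m \<circ> Inl"]])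
      (auto simp: mps_monom.rep_eq fun_eq_iff split: if_splits)
qed

lemma (in realization) finite_factors:
  assumes "\<tau> \<in> partition_families"
  shows "finite {k. qvar powi tits_form cscale form \<alpha> (part_vec \<tau> k) *
            qbinom_wt form \<alpha> (\<mu> k) (step_vec \<tau> k) \<noteq> 1}" (is "finite ?A")
    and "finite {k. qvar powi tits_form cscale form \<alpha> (part_vec \<tau> k) *
            qbinom_inf_wt (step_vec \<tau> k) \<noteq> 1}" (is "finite ?B")
proof -
  have fin: "finite (\<Union>i. {k. \<tau> i k \<noteq> 0})"
    using assms by (auto simp: partition_families_def)
  have T0: "tits_form cscale form \<alpha> (\<lambda>_. 0) = 0"
    using the_int_of_int[of 0] by (simp add: tits_form_def form_root_vec_root_vec)
  have "part_vec \<tau> k = (\<lambda>_. 0) \<and> step_vec \<tau> k = (\<lambda>_. 0)" if "k \<notin> (\<Union>i. {k. \<tau> i k \<noteq> 0})" for k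
    using that by (auto simp: part_vec_def step_vec_def)
  then have "k \<notin> ?A" "k \<notin> ?B" if "k \<notin> (\<Union>i. {k. \<tau> i k \<noteq> 0})" for k
    using T0 that by (simp_all add: qbinom_wt_def qbinom_inf_wt_def qbinom_def qbinom_inf_def)
  then have "?A \<subseteq> (\<Union>i. {k. \<tau> i k \<noteq> 0})" "?B \<subseteq> (\<Union>i. {k. \<tau> i k \<noteq> 0})"
    by blast+
  then show "finite ?A" "finite ?B"
    using fin by (auto intro: finite_subset)
qed

end

theory Submission
  imports Defs
begin

text \<open>
  By the \<open>q\<close>-binomial theorem \<open>[n, m]\<close> is the sum of \<open>q\<^sup>n\<^sup>b [\<infinity>, a]\<close> times the conjugate of \<open>[\<infinity>, b]\<close> over
  \<open>a + b = m\<close>. Expanding every factor of \<open>s(\<nu>)\<close> in this way amounts to writing \<open>\<tau> = \<sigma> + \<rho>\<close> with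
  partitions \<open>\<sigma>\<close>, \<open>\<rho>\<close> whose steps are the chosen \<open>a\<close> and \<open>b\<close>. The resulting exponent of \<open>q\<close> equals
  \<open>(\<nu>, \<rho>\<^sub>1) + \<Sum>\<^sub>k (T(\<sigma>\<^sub>k) - T(\<rho>\<^sub>k))\<close>, so the sum over all pairs is the product of the two series.
\<close>

section \<open>Conjugation on the coefficient field and the q-binomial theorem\<close>

lemma qvar_power_neq_1: "k > 0 \<Longrightarrow> qvar ^ k \<noteq> 1"
proof
  assume "k > 0" and "qvar ^ k = 1"
  have "to_fract ([:0, 1:] ^ n) = qvar ^ n" for n
    by (induction n) (simp_all only: power_0 power_Suc to_fract_1 to_fract_mult qvar_def)
  with \<open>qvar ^ k = 1\<close> have "to_fract ([:0, 1:] ^ k :: rat poly) = to_fract 1"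
    by simp
  then have "degree ([:0, 1:] ^ k :: rat poly) = degree (1 :: rat poly)"
    by (simp only: to_fract_eq_iff)
  with \<open>k > 0\<close> show False
    by (simp add: degree_power_eq)
qed

lemma qconj_0 [simp]: "qconj 0 = 0"
  using qconj_to_fract[of 0] by simp

lemma qconj_1 [simp]: "qconj 1 = 1"
proof -
  have "eval_qinv 1 = 1"
    by (simp add: one_pCons flip: to_fract_1)
  then show ?thesis
    using qconj_to_fract[of 1] by simp
qed

lemma qconj_sum: "qconj (\<Sum>x\<in>A. f x) = (\<Sum>x\<in>A. qconj (f x))"
  by (induction A rule: infinite_finite_induct) (simp_all add: qconj_add)

lemma qconj_prod: "qconj (\<Prod>x\<in>A. f x) = (\<Prod>x\<in>A. qconj (f x))"
  by (induction A rule: infinite_finite_induct) (simp_all add: qconj_mult)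

lemma qconj_inverse: "qconj (inverse f) = inverse (qconj f)"
proof (cases "f = 0")
  case False
  then have "qconj f * qconj (inverse f) = 1"
    by (simp flip: qconj_mult)
  then show ?thesis
    by (metis inverse_unique)
qed simp

lemma qconj_power: "qconj (f ^ n) = qconj f ^ n"
  by (induction n) (simp_all add: qconj_mult)

lemma qconj_qvar_powi: "qconj (qvar powi n) = qvar powi (- n)"
  by (simp add: power_int_def qconj_power qconj_inverse qconj_qvar)

lemma qconj_diff: "qconj (f - g) = qconj f - qconj g"
  using qconj_add[of "f - g" g] by simp

lemma qbinom_inf_Suc: "(1 - qvar ^ Suc m) * qbinom_inf (Suc m) = qbinom_inf m"
  using qvar_power_neq_1[of "Suc m"] by (simp add: qbinom_inf_def del: power_Suc)

text \<open>The conjugate of \<open>qbinom_inf_Suc\<close>, multiplied by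
  \<open>qvar ^ Suc m\<close> to clear the negative powers of q.\<close>

lemma qconj_qbinom_inf_Suc:
  "qvar ^ Suc m * qconj (qbinom_inf m) = (qvar ^ Suc m - 1) * qconj (qbinom_inf (Suc m))"
proof -
  have "qconj (qbinom_inf m) = (1 - inverse qvar ^ Suc m) * qconj (qbinom_inf (Suc m))"
    by (subst qbinom_inf_Suc[symmetric])
      (simp add: qconj_mult qconj_diff qconj_power qconj_qvar del: power_Suc)
  moreover have "qvar ^ Suc m * inverse qvar ^ Suc m = 1"
    by (simp flip: power_mult_distrib del: power_Suc)
  ultimately show ?thesis
    by (simp only: mult.assoc[symmetric] right_diff_distrib mult_1_right)
qed

text \<open>A recursion in the lower index at fixed \<open>n\<close>. Its factor
  \<open>1 - qvar ^ Suc m\<close> is nonzero, so together with the value 1 at \<open>m = 0\<close>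
  it determines \<open>qbinom n\<close>.\<close>

lemma qbinom_Suc:
  "(1 - qvar ^ Suc m) * qbinom n (Suc m) = (1 - qvar powi n * qvar ^ Suc m) * qbinom n m"
proof -
  have "qvar powi (n + int (Suc m)) = qvar powi n * qvar ^ Suc m"
    by (simp only: power_int_add qvar_nonzero power_int_of_nat simp_thms)
  then have "qbinom n (Suc m) = qbinom n m * ((1 - qvar powi n * qvar ^ Suc m) / (1 - qvar ^ Suc m))"
    by (simp add: qbinom_def del: power_Suc of_nat_Suc)
  then show ?thesis
    using qvar_power_neq_1[of "Suc m"] by (simp del: power_Suc)
qed

text \<open>Conjugating \<open>qbinom_inf b\<close> multiplies it by (-1)^b q^(b(b+1)/2), so this is
  the classical finite expansion of the product of the 1 - w q^k with w = q^n, divided by the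
  product of the 1 - q^k. The induction checks that the right-hand side obeys the recursion
  \<open>qbinom_Suc\<close>.\<close>

lemma qbinom_expand:
  "qbinom n m = (\<Sum>b\<le>m. qvar powi (n * int b) * (qbinom_inf (m - b) * qconj (qbinom_inf b)))"
proof (induction m)
  case 0
  then show ?case by (simp add: qbinom_def qbinom_inf_def)
next
  case (Suc m)
  \<comment> \<open>The upper index enters only through \<open>w\<close>, in which both sides are
    polynomials; the possibly negative exponents become natural powers of \<open>w\<close>.\<close>
  define w where "w = qvar powi n"
  have w: "qvar powi (n * int b) = w ^ b" for b
    by (simp add: w_def power_int_mult)
  let ?h = qbinom_inf and ?e = "\<lambda>b. qconj (qbinom_inf b)"
  have "(1 - qvar ^ Suc m) * (\<Sum>b\<le>Suc m. w ^ b * (?h (Suc m - b) * ?e b)) =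
    (\<Sum>b\<le>Suc m. w ^ b * ((1 - qvar ^ (Suc m - b)) * ?h (Suc m - b)) * ?e b) +
    (\<Sum>b\<le>Suc m. w ^ b * ?h (Suc m - b) * (qvar ^ (Suc m - b) * (1 - qvar ^ b) * ?e b))"
  proof -
    \<comment> \<open>In this splitting the first summand lowers the index of
      \<open>qbinom_inf\<close>, the second that of its conjugate.\<close>
    have "1 - qvar ^ Suc m = (1 - qvar ^ (Suc m - b)) + qvar ^ (Suc m - b) * (1 - qvar ^ b)"
      if "b \<le> Suc m" for b
      using that by (simp add: algebra_simps flip: power_add del: power_Suc)
    then show ?thesis
      unfolding sum_distrib_left sum.distrib[symmetric]
      by (intro sum.cong refl) (simp add: algebra_simps)
  qed
  also have "(\<Sum>b\<le>Suc m. w ^ b * ((1 - qvar ^ (Suc m - b)) * ?h (Suc m - b)) * ?e b) =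
      (\<Sum>b\<le>m. w ^ b * (?h (m - b) * ?e b))"
  proof -
    have "w ^ b * ((1 - qvar ^ (Suc m - b)) * ?h (Suc m - b)) * ?e b = w ^ b * (?h (m - b) * ?e b)"
      if "b \<le> m" for b
      using that by (simp only: Suc_diff_le qbinom_inf_Suc mult.assoc)
    then have "(\<Sum>b\<le>m. w ^ b * ((1 - qvar ^ (Suc m - b)) * ?h (Suc m - b)) * ?e b) =
        (\<Sum>b\<le>m. w ^ b * (?h (m - b) * ?e b))"
      by (rule sum.cong[OF refl]) simp
    \<comment> \<open>The extra term \<open>b = Suc m\<close> contains the factor
      \<open>1 - qvar ^ 0\<close> and vanishes.\<close>
    then show ?thesis by simp
  qed
  also have "(\<Sum>b\<le>Suc m. w ^ b * ?h (Suc m - b) * (qvar ^ (Suc m - b) * (1 - qvar ^ b) * ?e b)) =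
      - (w * qvar ^ Suc m) * (\<Sum>b\<le>m. w ^ b * (?h (m - b) * ?e b))"
  proof -
    \<comment> \<open>The powers \<open>m - b\<close> and \<open>Suc b\<close> add up to
      \<open>Suc m\<close>, so the factor no longer depends on \<open>b\<close> and can leave the
      sum.\<close>
    have e_Suc: "qvar ^ (m - b) * (1 - qvar ^ Suc b) * ?e (Suc b) = - (qvar ^ Suc m * ?e b)" if "b \<le> m" for b
    proof -
      have "qvar ^ (m - b) * ((1 - qvar ^ Suc b) * ?e (Suc b)) =
          qvar ^ (m - b) * (- (qvar ^ Suc b * ?e b))"
        unfolding qconj_qbinom_inf_Suc by (simp add: algebra_simps)
      also have "\<dots> = - (qvar ^ (m - b + Suc b) * ?e b)"
        by (simp add: power_add)
      finally show ?thesis using that by (simp add: mult.assoc)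
    qed
    have "w ^ Suc b * ?h (m - b) * (qvar ^ (m - b) * (1 - qvar ^ Suc b) * ?e (Suc b)) =
        - (w * qvar ^ Suc m) * (w ^ b * (?h (m - b) * ?e b))" if "b \<le> m" for b
      unfolding e_Suc[OF that] by (simp add: mult_ac)
    then have "(\<Sum>b\<le>m. w ^ Suc b * ?h (m - b) * (qvar ^ (m - b) * (1 - qvar ^ Suc b) * ?e (Suc b))) =
        (\<Sum>b\<le>m. - (w * qvar ^ Suc m) * (w ^ b * (?h (m - b) * ?e b)))"
      by (rule sum.cong[OF refl]) simp
    \<comment> \<open>After the index shift the term \<open>b = 0\<close> splits off; it is zero
      because of its factor \<open>1 - qvar ^ 0\<close>.\<close>
    then show ?thesis
      unfolding sum.atMost_Suc_shift sum_distrib_left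
      by (simp only: diff_Suc_Suc power_0 diff_self mult_zero_left mult_zero_right add_0)
  qed
  finally have "(1 - qvar ^ Suc m) * (\<Sum>b\<le>Suc m. w ^ b * (?h (Suc m - b) * ?e b)) =
      (1 - w * qvar ^ Suc m) * qbinom n m"
    using Suc.IH by (simp add: w algebra_simps)
  also have "\<dots> = (1 - qvar ^ Suc m) * qbinom n (Suc m)"
    by (simp only: qbinom_Suc w_def)
  finally show ?case
    using qvar_power_neq_1[of "Suc m"] by (simp add: w del: power_Suc)
qed

section \<open>Coefficients of sums of monomials and of their products\<close>

lemma mps_coeff_sum_monom:
  assumes "finite {t \<in> A. e t = m}"
  shows "mps_coeff (mps_sum (\<lambda>t. mps_monom (c t) (e t)) A) m = (\<Sum>t | t \<in> A \<and> e t = m. c t)"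
  unfolding mps_sum.rep_eq mps_monom.rep_eq
  \<comment> \<open>\<open>mps_sum\<close> collects only the members with nonzero coefficient at
    \<open>m\<close>. Finiteness of the fibre permits adding its members with
    \<open>c t = 0\<close>.\<close>
  by (intro sum.mono_neutral_cong_left) (use assms in \<open>auto split: if_splits\<close>)

text \<open>Sorting the pairs by their two exponents leaves a union of products of fibres over the
  finite set \<open>exponent_splits m\<close>. This serves both the Cauchy product and the
  finiteness of the index set.\<close>

lemma exponent_sum_fibre:
  "{(s, t). s \<in> A \<and> t \<in> B \<and> (\<forall>v. e s v + e' t v = m v)} =
    (\<Union>p\<in>exponent_splits m. {s \<in> A. e s = fst p} \<times> {t \<in> B. e' t = snd p})"
  by (force simp: exponent_splits_def)

lemma mps_coeff_mult_sum_monom: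
  fixes e :: "'s \<Rightarrow> 'v::finite \<Rightarrow> nat" and e' :: "'t \<Rightarrow> 'v \<Rightarrow> nat" and c :: "'s \<Rightarrow> 'a::comm_ring_1"
  assumes A: "\<And>m. finite {s \<in> A. e s = m}" and B: "\<And>m. finite {t \<in> B. e' t = m}"
  shows "mps_coeff (mps_sum (\<lambda>s. mps_monom (c s) (e s)) A * mps_sum (\<lambda>t. mps_monom (d t) (e' t)) B) m =
    (\<Sum>(s, t) | s \<in> A \<and> t \<in> B \<and> (\<forall>v. e s v + e' t v = m v). c s * d t)"
proof -
  have "mps_coeff (mps_sum (\<lambda>s. mps_monom (c s) (e s)) A * mps_sum (\<lambda>t. mps_monom (d t) (e' t)) B) m =
    (\<Sum>p\<in>exponent_splits m. \<Sum>(s, t)\<in>{s \<in> A. e s = fst p} \<times> {t \<in> B. e' t = snd p}. c s * d t)"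
    unfolding times_mps.rep_eq mps_coeff_sum_monom[OF A] mps_coeff_sum_monom[OF B]
      sum_product case_prod_unfold
    by (simp add: sum.cartesian_product case_prod_unfold)
  also have "\<dots> = (\<Sum>(s, t) | s \<in> A \<and> t \<in> B \<and> (\<forall>v. e s v + e' t v = m v). c s * d t)"
    unfolding exponent_sum_fibre by (rule sum.UNION_disjoint[symmetric]) (use A B in auto)
  finally show ?thesis .
qed

section \<open>Splitting families of partitions into part-by-part sums\<close>

definition partition_splits ::
    "('i \<Rightarrow> nat \<Rightarrow> nat) \<Rightarrow> (('i \<Rightarrow> nat \<Rightarrow> nat) \<times> ('i \<Rightarrow> nat \<Rightarrow> nat)) set" where
  "partition_splits \<tau> = {(\<sigma>, \<rho>). \<sigma> \<in> partition_families \<and> \<rho> \<in> partition_families \<and>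
     (\<forall>i k. \<sigma> i k + \<rho> i k = \<tau> i k)}"

lemma partition_family_add:
  assumes "\<sigma> \<in> partition_families" "\<rho> \<in> partition_families"
  shows "(\<lambda>i k. \<sigma> i k + \<rho> i k) \<in> partition_families"
proof -
  have "{k. \<sigma> i k + \<rho> i k \<noteq> 0} = {k. \<sigma> i k \<noteq> 0} \<union> {k. \<rho> i k \<noteq> 0}" for i
    by auto
  with assms show ?thesis
    by (auto simp: partition_families_def decseq_def intro: add_mono)
qed

lemma size_vec_add:
  assumes "\<sigma> \<in> partition_families" "\<rho> \<in> partition_families"
  shows "size_vec (\<lambda>i k. \<sigma> i k + \<rho> i k) i = size_vec \<sigma> i + size_vec \<rho> i"
  using assms by (simp add: size_vec_def part_vec_def partition_families_def Sum_any.distrib)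

text \<open>Since \<open>'i\<close> is finite, one bound serves all components at once.\<close>

lemma partition_family_eventually_0:
  fixes \<tau> :: "'i::finite \<Rightarrow> nat \<Rightarrow> nat"
  assumes "\<tau> \<in> partition_families"
  obtains N where "\<And>i k. k \<ge> N \<Longrightarrow> \<tau> i k = 0"
proof -
  have "finite (\<Union>i. {k. \<tau> i k \<noteq> 0})"
    using assms by (auto simp: partition_families_def)
  then obtain N where "\<forall>k \<in> (\<Union>i. {k. \<tau> i k \<noteq> 0}). k < N"
    by (metis finite_nat_set_iff_bounded)
  then have "\<And>i k. k \<ge> N \<Longrightarrow> \<tau> i k = 0"
    by (meson UN_I UNIV_I linorder_not_less mem_Collect_eq)
  then show thesis by (rule that)
qed

text \<open>A partition is recovered from its steps by telescoping: natural subtraction is exact on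
  a decreasing sequence, and the end term vanishes.\<close>

lemma sum_steps:
  fixes r :: "nat \<Rightarrow> nat"
  assumes "decseq r" "\<And>k. k \<ge> N \<Longrightarrow> r k = 0"
  shows "(\<Sum>l\<in>{k..<N}. r l - r (Suc l)) = r k"
proof (cases "k \<le> N")
  case True
  then show ?thesis
  proof (induction k rule: inc_induct)
    case (step k)
    then show ?case
      using decseq_SucD[OF assms(1), of k] by (simp add: sum.atLeast_Suc_lessThan)
  qed (simp add: assms(2))
qed (simp add: assms(2))

text \<open>Distributing the product chooses a number \<open>b\<close> at every position
  \<open>(k, i)\<close>. These choices are exactly the possible steps of \<open>\<rho>\<close>: tail
  sums turn a choice into \<open>\<rho>\<close>, the difference \<open>\<tau> - \<rho>\<close> is
  \<open>\<sigma>\<close>, and taking steps of \<open>\<rho>\<close> inverts the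
  construction.\<close>

lemma prod_sum_partition_splits:
  fixes \<tau> :: "'i::finite \<Rightarrow> nat \<Rightarrow> nat" and f :: "nat \<Rightarrow> 'i \<Rightarrow> nat \<Rightarrow> nat \<Rightarrow> 'a::comm_ring_1"
  assumes \<tau>: "\<tau> \<in> partition_families" and N: "\<And>i k. k \<ge> N \<Longrightarrow> \<tau> i k = 0"
  shows "(\<Prod>k<N. \<Prod>i\<in>UNIV. \<Sum>b\<le>step_vec \<tau> k i. f k i (step_vec \<tau> k i - b) b) =
    (\<Sum>(\<sigma>, \<rho>)\<in>partition_splits \<tau>. \<Prod>k<N. \<Prod>i\<in>UNIV. f k i (step_vec \<sigma> k i) (step_vec \<rho> k i))"
proof -
  define I where "I = {..<N} \<times> (UNIV :: 'i set)"
  \<comment> \<open>Tail sums, so that \<open>r g\<close> has the prescribed steps \<open>g\<close>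
    and ends before \<open>N\<close>.\<close>
  define r where "r g i k = (\<Sum>l\<in>{k..<N}. g (l, i))" for g :: "nat \<times> 'i \<Rightarrow> nat" and i k
  \<comment> \<open>Extensional functions make each choice a unique object; this is why the inverse
    map below uses \<open>restrict\<close>.\<close>
  define G where "G = (\<Pi>\<^sub>E p\<in>I. {..step_vec \<tau> (fst p) (snd p)})"
  have dec: "decseq (\<tau> i)" for i
    using \<tau> by (simp add: partition_families_def)
  have r_step: "r g i k = g (k, i) + r g i (Suc k)" if "k < N" for g i k
    using that by (simp add: r_def sum.atLeast_Suc_lessThan)
  have r_0: "r g i k = 0" if "k \<ge> N" for g i k
    using that by (simp add: r_def)
  have g_le: "g (k, i) + \<tau> i (Suc k) \<le> \<tau> i k" if "g \<in> G" "k < N" for g i k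
  proof -
    have "g (k, i) \<le> \<tau> i k - \<tau> i (Suc k)"
      using that by (auto simp: G_def I_def PiE_iff step_vec_def part_vec_def)
    then show ?thesis
      using decseq_SucD[OF dec, of i k] by linarith
  qed
  have r_le: "r g i k \<le> \<tau> i k" if "g \<in> G" for g i k
  proof -
    have "r g i k \<le> (\<Sum>l\<in>{k..<N}. \<tau> i l - \<tau> i (Suc l))"
      unfolding r_def using that
      by (intro sum_mono) (auto simp: G_def I_def PiE_iff step_vec_def part_vec_def)
    also have "\<dots> = \<tau> i k"
      using dec N by (rule sum_steps)
    finally show ?thesis .
  qed
  have pf: "\<rho> \<in> partition_families"
    if "\<And>i k. k < N \<Longrightarrow> \<rho> i (Suc k) \<le> \<rho> i k" "\<And>i k. k \<ge> N \<Longrightarrow> \<rho> i k = 0" for \<rho> :: "'i \<Rightarrow> nat \<Rightarrow> nat"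
  proof -
    have "\<rho> i (Suc k) \<le> \<rho> i k" for i k
      using that by (cases "k < N") auto
    moreover have "finite {k. \<rho> i k \<noteq> 0}" for i
      by (rule finite_subset[of _ "{..<N}"]) (use that(2) in \<open>auto intro: leI ccontr\<close>)
    ultimately show ?thesis
      by (simp add: partition_families_def decseq_Suc_iff)
  qed
  have "(\<Prod>k<N. \<Prod>i\<in>UNIV. \<Sum>b\<le>step_vec \<tau> k i. f k i (step_vec \<tau> k i - b) b) =
    (\<Prod>p\<in>I. \<Sum>b\<le>step_vec \<tau> (fst p) (snd p). f (fst p) (snd p) (step_vec \<tau> (fst p) (snd p) - b) b)"
    by (simp add: I_def prod.cartesian_product case_prod_unfold)
  also have "\<dots> = (\<Sum>g\<in>G. \<Prod>p\<in>I. f (fst p) (snd p) (step_vec \<tau> (fst p) (snd p) - g p) (g p))"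
    unfolding G_def by (rule prod_sum_PiE) (auto simp: I_def)
  also have "\<dots> = (\<Sum>(\<sigma>, \<rho>)\<in>partition_splits \<tau>. \<Prod>p\<in>I.
      f (fst p) (snd p) (step_vec \<sigma> (fst p) (snd p)) (step_vec \<rho> (fst p) (snd p)))"
  proof (rule sum.reindex_bij_witness[of _
        "\<lambda>(\<sigma>, \<rho>). restrict (\<lambda>(k, i). step_vec \<rho> k i) I"
        "\<lambda>g. (\<lambda>i k. \<tau> i k - r g i k, r g)"])
    fix g assume g: "g \<in> G"
    have step_r: "step_vec (r g) k i = g (k, i)" if "k < N" for k i
      using that by (simp add: step_vec_def part_vec_def r_step[of k])
    \<comment> \<open>All these subtractions are truncated; \<open>r_le\<close> and
      \<open>g_le\<close> make them exact.\<close>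
    have step_diff: "step_vec (\<lambda>i k. \<tau> i k - r g i k) k i = step_vec \<tau> k i - g (k, i)"
      if "k < N" for k i
      using r_le[OF g, of i "Suc k"] g_le[OF g that, of i] that
      by (simp add: step_vec_def part_vec_def r_step[of k])
    show "(case (\<lambda>i k. \<tau> i k - r g i k, r g) of
        (\<sigma>, \<rho>) \<Rightarrow> restrict (\<lambda>(k, i). step_vec \<rho> k i) I) = g"
      using g by (auto simp: G_def I_def step_r PiE_iff extensional_def restrict_def fun_eq_iff)
    have "(\<lambda>i k. \<tau> i k - r g i k) \<in> partition_families"
    proof (rule pf)
      fix i k assume "k < N"
      then show "\<tau> i (Suc k) - r g i (Suc k) \<le> \<tau> i k - r g i k"
        using r_le[OF g, of i "Suc k"] g_le[OF g, of k i] by (simp add: r_step[of k])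
    qed (simp add: N)
    moreover have "r g \<in> partition_families"
      by (rule pf) (simp_all add: r_step r_0)
    ultimately show "(\<lambda>i k. \<tau> i k - r g i k, r g) \<in> partition_splits \<tau>"
      by (simp add: partition_splits_def r_le[OF g])
    show "(case (\<lambda>i k. \<tau> i k - r g i k, r g) of (\<sigma>, \<rho>) \<Rightarrow> \<Prod>p\<in>I.
        f (fst p) (snd p) (step_vec \<sigma> (fst p) (snd p)) (step_vec \<rho> (fst p) (snd p))) =
      (\<Prod>p\<in>I. f (fst p) (snd p) (step_vec \<tau> (fst p) (snd p) - g p) (g p))"
      by (auto simp: I_def step_r step_diff intro!: prod.cong)
  next
    fix p assume "p \<in> partition_splits \<tau>"
    then obtain \<sigma> \<rho> where p: "p = (\<sigma>, \<rho>)" and \<sigma>: "\<sigma> \<in> partition_families"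
      and \<rho>: "\<rho> \<in> partition_families" and sum: "\<And>i k. \<sigma> i k + \<rho> i k = \<tau> i k"
      by (auto simp: partition_splits_def)
    have decs: "decseq (\<sigma> i)" "decseq (\<rho> i)" for i
      using \<sigma> \<rho> by (auto simp: partition_families_def)
    have zero: "\<rho> i k = 0" if "k \<ge> N" for i k
      using sum[of i k] N[OF that, of i] by simp
    have "r (restrict (\<lambda>(k, i). step_vec \<rho> k i) I) i k = \<rho> i k" for i k
    proof -
      have "r (restrict (\<lambda>(k, i). step_vec \<rho> k i) I) i k = (\<Sum>l\<in>{k..<N}. \<rho> i l - \<rho> i (Suc l))"
        unfolding r_def by (rule sum.cong) (auto simp: I_def step_vec_def part_vec_def)
      also have "\<dots> = \<rho> i k"
        using decs(2) zero by (rule sum_steps)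
      finally show ?thesis .
    qed
    then have r_eq: "r (restrict (\<lambda>(k, i). step_vec \<rho> k i) I) = \<rho>"
      by (simp add: fun_eq_iff)
    have "\<tau> i k - \<rho> i k = \<sigma> i k" for i k
      using sum[of i k] by simp
    then show "(\<lambda>i k. \<tau> i k - r (case p of (\<sigma>, \<rho>) \<Rightarrow> restrict (\<lambda>(k, i). step_vec \<rho> k i) I) i k,
        r (case p of (\<sigma>, \<rho>) \<Rightarrow> restrict (\<lambda>(k, i). step_vec \<rho> k i) I)) = p"
      by (simp add: p r_eq)
    \<comment> \<open>The steps of \<open>\<tau>\<close> are those of \<open>\<rho>\<close> plus
      those of \<open>\<sigma>\<close>, and the latter are nonnegative because
      \<open>\<sigma>\<close> decreases.\<close>
    have "\<rho> i k - \<rho> i (Suc k) \<le> \<tau> i k - \<tau> i (Suc k)" for i k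
      using decseq_SucD[OF decs(1), of i k] by (simp flip: sum)
    then show "(case p of (\<sigma>, \<rho>) \<Rightarrow> restrict (\<lambda>(k, i). step_vec \<rho> k i) I) \<in> G"
      by (auto simp: p G_def PiE_iff step_vec_def part_vec_def)
  qed
  also have "\<dots> = (\<Sum>(\<sigma>, \<rho>)\<in>partition_splits \<tau>. \<Prod>k<N. \<Prod>i\<in>UNIV.
      f k i (step_vec \<sigma> k i) (step_vec \<rho> k i))"
    by (simp add: I_def prod.cartesian_product case_prod_unfold)
  finally show ?thesis .
qed

section \<open>Summation by parts and finiteness of products and fibres\<close>

lemma abel_summation:
  fixes f r :: "nat \<Rightarrow> int"
  shows "(\<Sum>k<N. (\<Sum>l\<le>k. f l) * (r k - r (Suc k))) = (\<Sum>l<N. f l * r l) - (\<Sum>l<N. f l) * r N"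
  by (induction N) (simp_all add: algebra_simps lessThan_Suc_atMost[symmetric])

lemma power_int_sum:
  fixes x :: "'a::field"
  assumes "x \<noteq> 0"
  shows "x powi (\<Sum>i\<in>A. f i) = (\<Prod>i\<in>A. x powi f i)"
  by (induction A rule: infinite_finite_induct) (simp_all add: assms power_int_add)

lemma Prod_any_eq_prod_lessThan:
  fixes N :: nat
  assumes "\<And>k. k \<ge> N \<Longrightarrow> f k = 1"
  shows "Prod_any f = (\<Prod>k<N. f k)"
proof (rule Prod_any.expand_superset)
  show "{k. f k \<noteq> 1} \<subseteq> {..<N}"
    using assms leI by blast
qed simp

text \<open>The x-exponent is the size, which alone leaves finitely many families.\<close>

lemma finite_monomial_fibre_partition_families:
  "finite {\<tau> \<in> partition_families. case_sum (size_vec \<tau>) (part_vec \<tau> 0) = m}"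
  for m :: "'i::finite + 'i \<Rightarrow> nat"
proof (rule finite_subset)
  show "{\<tau> \<in> partition_families. case_sum (size_vec \<tau>) (part_vec \<tau> 0) = m} \<subseteq>
      {\<tau> \<in> partition_families. size_vec \<tau> = m \<circ> Inl}"
    by (auto simp: case_sum_o_inj)
qed (rule finite_fibre_partition_families)

section \<open>Pairings, the Tits form and the exponent of q\<close>

context realization
begin

lemma tits_form_0 [simp]: "tits_form cscale form \<alpha> (\<lambda>_. 0) = 0"
  using the_int_of_int[of 0] by (simp add: tits_form_def form_root_vec_root_vec)

lemma weight_comp_diff_root_vecs:
  assumes "\<nu> \<in> weight_lattice form \<alpha>"
  shows "weight_comp form \<alpha> (\<nu> - (\<Sum>l\<le>k. root_vec cscale \<alpha> (a l))) i =
    weight_comp form \<alpha> \<nu> i - (\<Sum>l\<le>k. \<Sum>j\<in>UNIV. C i j * int (a l j))"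
proof -
  \<comment> \<open>\<open>form_linear\<close> gives linearity in the second argument, so
    \<open>form_sym\<close> first moves the varying vector there.\<close>
  interpret l: Vector_Spaces.linear cscale "(*)" "form (\<alpha> i)"
    by (rule form_linear)
  have "form (\<nu> - (\<Sum>l\<le>k. root_vec cscale \<alpha> (a l))) (\<alpha> i) =
      form \<nu> (\<alpha> i) - (\<Sum>l\<le>k. form (\<alpha> i) (root_vec cscale \<alpha> (a l)))"
    by (simp add: form_sym[of _ "\<alpha> i"] l.diff l.sum)
  also have "\<dots> = of_int (weight_comp form \<alpha> \<nu> i - (\<Sum>l\<le>k. \<Sum>j\<in>UNIV. C i j * int (a l j)))"
    by (simp add: form_root_vec form_simple_roots weight_comp_eq[OF assms])
  finally show ?thesis
    by (simp only: weight_comp_def the_int_of_int)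
qed

text \<open>Polarization: T(a+b) = T(a) + (a,b) + T(b), while (a+b,b) = (a,b) + 2T(b).\<close>

lemma tits_form_add:
  assumes "\<And>i. C i i = 2"
  shows "tits_form cscale form \<alpha> (\<lambda>i. a i + b i) -
      (\<Sum>i\<in>UNIV. (\<Sum>j\<in>UNIV. C i j * int (a j + b j)) * int (b i)) =
    tits_form cscale form \<alpha> a - tits_form cscale form \<alpha> b"
proof -
  define B where "B x y = (\<Sum>i\<in>UNIV. \<Sum>j\<in>UNIV. C i j * int (x i) * int (y j))"
    for x y :: "'i \<Rightarrow> nat"
  have C_sym: "C i j = C j i" for i j
    using form_sym[of "\<alpha> i" "\<alpha> j"] by (simp add: form_simple_roots)
  have sym: "B a b = B b a"
  proof -
    have "B a b = (\<Sum>j\<in>UNIV. \<Sum>i\<in>UNIV. C i j * int (a i) * int (b j))"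
      unfolding B_def by (rule sum.swap)
    also have "\<dots> = B b a"
      unfolding B_def
    proof (intro sum.cong refl)
      show "C i j * int (a i) * int (b j) = C j i * int (b j) * int (a i)" for i j
        by (simp only: C_sym[of i j] mult_ac)
    qed
    finally show ?thesis .
  qed
  have "B (\<lambda>i. a i + b i) (\<lambda>i. a i + b i) = B a a + B a b + B b a + B b b"
    by (simp add: B_def distrib_left distrib_right sum.distrib)
  moreover have "(\<Sum>i\<in>UNIV. (\<Sum>j\<in>UNIV. C i j * int (a j + b j)) * int (b i)) = B b a + B b b"
  proof -
    have "(\<Sum>j\<in>UNIV. C i j * int (a j + b j)) * int (b i) =
        (\<Sum>j\<in>UNIV. C i j * int (b i) * int (a j) + C i j * int (b i) * int (b j))" for i
      unfolding sum_distrib_right by (intro sum.cong refl) (simp add: algebra_simps)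
    then show ?thesis
      by (simp add: B_def sum.distrib)
  qed
  \<comment> \<open>The identity is proved after doubling, which avoids halves in the
    integers.\<close>
  moreover have "2 * tits_form cscale form \<alpha> x = B x x" for x
    unfolding B_def by (rule tits_form_eq[OF assms])
  ultimately have "2 * tits_form cscale form \<alpha> (\<lambda>i. a i + b i) =
    2 * (\<Sum>i\<in>UNIV. (\<Sum>j\<in>UNIV. C i j * int (a j + b j)) * int (b i)) +
    2 * tits_form cscale form \<alpha> a - 2 * tits_form cscale form \<alpha> b"
    using sym by simp
  then show ?thesis by linarith
qed

text \<open>
  Summation by parts turns the cross terms into \<open>\<Sum>\<^sub>k (\<sigma>\<^sub>k + \<rho>\<^sub>k, \<rho>\<^sub>k)\<close>, which is exactly what separates
  \<open>T(\<sigma>\<^sub>k + \<rho>\<^sub>k)\<close> into \<open>T(\<sigma>\<^sub>k) - T(\<rho>\<^sub>k)\<close>.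
\<close>

lemma exponent_split:
  fixes n :: "'i \<Rightarrow> int"
  assumes diag: "\<And>i. C i i = 2"
    and \<rho>: "\<rho> \<in> partition_families" and zero: "\<And>i. \<rho> i N = 0"
    and \<tau>: "\<And>i k. \<tau> i k = \<sigma> i k + \<rho> i k"
  shows "(\<Sum>k<N. tits_form cscale form \<alpha> (part_vec \<tau> k) +
      (\<Sum>i\<in>UNIV. (n i - (\<Sum>l\<le>k. \<Sum>j\<in>UNIV. C i j * int (part_vec \<tau> l j))) * int (step_vec \<rho> k i))) =
    (\<Sum>i\<in>UNIV. n i * int (\<rho> i 0)) +
    (\<Sum>k<N. tits_form cscale form \<alpha> (part_vec \<sigma> k) - tits_form cscale form \<alpha> (part_vec \<rho> k))"
proof -
  \<comment> \<open>\<open>f i l\<close> is the pairing of \<alpha>_i with the vector of parts of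
    \<open>\<tau>\<close> at index \<open>l\<close>.\<close>
  define f where "f i l = (\<Sum>j\<in>UNIV. C i j * int (\<tau> j l))" for i l
  have step: "int (step_vec \<rho> k i) = int (\<rho> i k) - int (\<rho> i (Suc k))" for k i
    using \<rho> decseq_SucD[of "\<rho> i" k]
    by (simp add: partition_families_def step_vec_def part_vec_def)
  \<comment> \<open>Telescoping leaves the first part, at index 0, since \<open>\<rho>\<close>
    vanishes at \<open>N\<close>.\<close>
  have weight: "(\<Sum>k<N. n i * (int (\<rho> i k) - int (\<rho> i (Suc k)))) = n i * int (\<rho> i 0)" for i
    using sum_lessThan_telescope'[of "\<lambda>k. int (\<rho> i k)" N]
    by (simp add: sum_distrib_left[symmetric] zero)
  have "(\<Sum>k<N. \<Sum>i\<in>UNIV. (n i - (\<Sum>l\<le>k. f i l)) * int (step_vec \<rho> k i)) =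
      (\<Sum>i\<in>UNIV. \<Sum>k<N. (n i - (\<Sum>l\<le>k. f i l)) * (int (\<rho> i k) - int (\<rho> i (Suc k))))"
    unfolding step by (rule sum.swap)
  \<comment> \<open>The boundary term of \<open>abel_summation\<close> disappears because
    \<open>\<rho>\<close> is zero at \<open>N\<close>.\<close>
  also have "\<dots> = (\<Sum>i\<in>UNIV. n i * int (\<rho> i 0) - (\<Sum>k<N. f i k * int (\<rho> i k)))"
    unfolding left_diff_distrib[of "n _"] sum_subtractf weight
    by (simp add: abel_summation[of "f _" "\<lambda>k. int (\<rho> _ k)"] zero)
  also have "\<dots> = (\<Sum>i\<in>UNIV. n i * int (\<rho> i 0)) - (\<Sum>k<N. \<Sum>i\<in>UNIV. f i k * int (\<rho> i k))"
    unfolding sum_subtractf by (subst sum.swap) simp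
  finally have sum: "(\<Sum>k<N. \<Sum>i\<in>UNIV. (n i - (\<Sum>l\<le>k. f i l)) * int (step_vec \<rho> k i)) =
      (\<Sum>i\<in>UNIV. n i * int (\<rho> i 0)) - (\<Sum>k<N. \<Sum>i\<in>UNIV. f i k * int (\<rho> i k))" .
  have "tits_form cscale form \<alpha> (part_vec \<tau> k) - (\<Sum>i\<in>UNIV. f i k * int (\<rho> i k)) =
      tits_form cscale form \<alpha> (part_vec \<sigma> k) - tits_form cscale form \<alpha> (part_vec \<rho> k)" for k
    using tits_form_add[OF diag, of "part_vec \<sigma> k" "part_vec \<rho> k"]
    by (simp add: part_vec_def f_def \<tau>)
  then have "(\<Sum>k<N. tits_form cscale form \<alpha> (part_vec \<tau> k)) - (\<Sum>k<N. \<Sum>i\<in>UNIV. f i k * int (\<rho> i k)) =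
      (\<Sum>k<N. tits_form cscale form \<alpha> (part_vec \<sigma> k) - tits_form cscale form \<alpha> (part_vec \<rho> k))"
    unfolding sum_subtractf[symmetric] by simp
  with sum show ?thesis
    unfolding sum.distrib by (simp add: f_def part_vec_def)
qed

section \<open>Coefficientwise factorization of the series\<close>

definition wt_coeff :: "'h \<Rightarrow> ('i \<Rightarrow> nat \<Rightarrow> nat) \<Rightarrow> ratq" where
  "wt_coeff \<nu> \<tau> = Prod_any (\<lambda>k. qvar powi tits_form cscale form \<alpha> (part_vec \<tau> k) *
     qbinom_wt form \<alpha> (\<nu> - (\<Sum>l\<le>k. root_vec cscale \<alpha> (part_vec \<tau> l))) (step_vec \<tau> k))"

definition inf_coeff :: "('i \<Rightarrow> nat \<Rightarrow> nat) \<Rightarrow> ratq" where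
  "inf_coeff \<tau> = Prod_any (\<lambda>k. qvar powi tits_form cscale form \<alpha> (part_vec \<tau> k) *
     qbinom_inf_wt (step_vec \<tau> k))"

text \<open>\<open>N\<close> stays free so that both members of a split can be cut off at a bound
  for their sum.\<close>

lemma inf_coeff_eq:
  assumes "\<And>i k. k \<ge> N \<Longrightarrow> \<tau> i k = 0"
  shows "inf_coeff \<tau> = qvar powi (\<Sum>k<N. tits_form cscale form \<alpha> (part_vec \<tau> k)) *
    (\<Prod>k<N. \<Prod>i\<in>UNIV. qbinom_inf (step_vec \<tau> k i))"
proof -
  have one: "qvar powi tits_form cscale form \<alpha> (part_vec \<tau> k) * qbinom_inf_wt (step_vec \<tau> k) = 1"
    if "k \<ge> N" for k
    using that assms by (simp add: part_vec_def step_vec_def qbinom_inf_wt_def qbinom_inf_def)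
  have "inf_coeff \<tau> = (\<Prod>k<N. qvar powi tits_form cscale form \<alpha> (part_vec \<tau> k) *
      qbinom_inf_wt (step_vec \<tau> k))"
    unfolding inf_coeff_def by (rule Prod_any_eq_prod_lessThan[OF one])
  then show ?thesis
    by (simp add: prod.distrib power_int_sum qbinom_inf_wt_def)
qed

text \<open>The factorization for a single \<open>\<tau>\<close>: \<open>\<sigma>\<close> receives
  the factors \<open>qbinom_inf\<close>, \<open>\<rho>\<close> the conjugated ones, and
  \<open>exponent_split\<close> distributes the powers of q accordingly.\<close>

lemma wt_coeff_split:
  assumes diag: "\<And>i. C i i = 2" and \<nu>: "\<nu> \<in> weight_lattice form \<alpha>"
    and \<tau>: "\<tau> \<in> partition_families"
  shows "wt_coeff \<nu> \<tau> = (\<Sum>(\<sigma>, \<rho>)\<in>partition_splits \<tau>.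
    inf_coeff \<sigma> * (qvar powi weight_pairing cscale form \<alpha> \<nu> (part_vec \<rho> 0) * qconj (inf_coeff \<rho>)))"
proof -
  let ?T = "tits_form cscale form \<alpha>"
  obtain N where N: "\<And>i k. k \<ge> N \<Longrightarrow> \<tau> i k = 0"
    using partition_family_eventually_0[OF \<tau>] by blast
  \<comment> \<open>The upper index of the q-binomial at \<open>(k, i)\<close>. It depends on
    \<open>\<tau>\<close> only, hence is the same for all splits.\<close>
  define n where "n k i = weight_comp form \<alpha> \<nu> i - (\<Sum>l\<le>k. \<Sum>j\<in>UNIV. C i j * int (part_vec \<tau> l j))" for k i
  define h where "h k i a b = qvar powi (n k i * int b) * (qbinom_inf a * qconj (qbinom_inf b))"
    for k i a b
  have one: "qvar powi ?T (part_vec \<tau> k) * (\<Prod>i\<in>UNIV. qbinom (n k i) (step_vec \<tau> k i)) = 1"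
    if "k \<ge> N" for k
    using that N by (simp add: part_vec_def step_vec_def qbinom_def)
  have "wt_coeff \<nu> \<tau> = (\<Prod>k<N. qvar powi ?T (part_vec \<tau> k) * (\<Prod>i\<in>UNIV. qbinom (n k i) (step_vec \<tau> k i)))"
    unfolding wt_coeff_def qbinom_wt_def weight_comp_diff_root_vecs[OF \<nu>] n_def[symmetric]
    by (rule Prod_any_eq_prod_lessThan[OF one])
  also have "\<dots> = qvar powi (\<Sum>k<N. ?T (part_vec \<tau> k)) *
      (\<Prod>k<N. \<Prod>i\<in>UNIV. \<Sum>b\<le>step_vec \<tau> k i. h k i (step_vec \<tau> k i - b) b)"
    unfolding h_def by (simp add: prod.distrib power_int_sum flip: qbinom_expand)
  also have "\<dots> = (\<Sum>(\<sigma>, \<rho>)\<in>partition_splits \<tau>. qvar powi (\<Sum>k<N. ?T (part_vec \<tau> k)) *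
      (\<Prod>k<N. \<Prod>i\<in>UNIV. h k i (step_vec \<sigma> k i) (step_vec \<rho> k i)))"
    by (simp only: prod_sum_partition_splits[OF \<tau> N] sum_distrib_left case_prod_unfold)
  also have "\<dots> = (\<Sum>(\<sigma>, \<rho>)\<in>partition_splits \<tau>.
      inf_coeff \<sigma> * (qvar powi weight_pairing cscale form \<alpha> \<nu> (part_vec \<rho> 0) * qconj (inf_coeff \<rho>)))"
  proof (rule sum.cong[OF refl], clarify)
    fix \<sigma> \<rho> assume "(\<sigma>, \<rho>) \<in> partition_splits \<tau>"
    then have \<rho>: "\<rho> \<in> partition_families" and sum: "\<And>i k. \<tau> i k = \<sigma> i k + \<rho> i k"
      by (auto simp: partition_splits_def)
    have zero: "\<sigma> i k = 0" "\<rho> i k = 0" if "k \<ge> N" for i k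
      using sum[of i k] N[OF that, of i] by auto
    have "qvar powi (\<Sum>k<N. ?T (part_vec \<tau> k)) *
        (\<Prod>k<N. \<Prod>i\<in>UNIV. h k i (step_vec \<sigma> k i) (step_vec \<rho> k i)) =
      qvar powi (\<Sum>k<N. ?T (part_vec \<tau> k) + (\<Sum>i\<in>UNIV. n k i * int (step_vec \<rho> k i))) *
        ((\<Prod>k<N. \<Prod>i\<in>UNIV. qbinom_inf (step_vec \<sigma> k i)) *
         (\<Prod>k<N. \<Prod>i\<in>UNIV. qconj (qbinom_inf (step_vec \<rho> k i))))"
      by (simp add: h_def prod.distrib power_int_sum power_int_add sum.distrib mult_ac)
    also have "(\<Sum>k<N. ?T (part_vec \<tau> k) + (\<Sum>i\<in>UNIV. n k i * int (step_vec \<rho> k i))) =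
      (\<Sum>k<N. ?T (part_vec \<sigma> k)) +
        (weight_pairing cscale form \<alpha> \<nu> (part_vec \<rho> 0) - (\<Sum>k<N. ?T (part_vec \<rho> k)))"
      unfolding n_def exponent_split[OF diag \<rho> zero(2)[OF order_refl] sum] weight_pairing_eq[OF \<nu>]
      by (simp add: part_vec_def sum_subtractf)
    \<comment> \<open>The negative sign in front of the Tits forms of \<open>\<rho>\<close> is the
      one produced by conjugating the power of q in \<open>inf_coeff \<rho>\<close>.\<close>
    also have "qvar powi \<dots> = qvar powi (\<Sum>k<N. ?T (part_vec \<sigma> k)) *
        (qvar powi weight_pairing cscale form \<alpha> \<nu> (part_vec \<rho> 0) *
         qvar powi (- (\<Sum>k<N. ?T (part_vec \<rho> k))))"
      by (simp only: power_int_add qvar_nonzero simp_thms diff_conv_add_uminus)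
    finally show "qvar powi (\<Sum>k<N. ?T (part_vec \<tau> k)) *
        (\<Prod>k<N. \<Prod>i\<in>UNIV. h k i (step_vec \<sigma> k i) (step_vec \<rho> k i)) =
      inf_coeff \<sigma> * (qvar powi weight_pairing cscale form \<alpha> \<nu> (part_vec \<rho> 0) * qconj (inf_coeff \<rho>))"
      by (simp only: inf_coeff_eq[of N] zero qconj_mult qconj_prod qconj_qvar_powi mult_ac)
  qed
  finally show ?thesis .
qed

text \<open>Conjugation and shift act on coefficients and pass to the individual terms. This puts
  the second factor into the form required by \<open>mps_coeff_mult_sum_monom\<close>.\<close>

lemma shift_hom_conj_s_inf:
  "shift_hom cscale form \<alpha> \<nu> (series_conj (s_inf cscale form \<alpha>)) =
    mps_sum (\<lambda>\<tau>. mps_monom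
        (qvar powi weight_pairing cscale form \<alpha> \<nu> (part_vec \<tau> 0) * qconj (inf_coeff \<tau>))
        (case_sum (size_vec \<tau>) (part_vec \<tau> 0)))
      partition_families"
proof (rule mps_eqI)
  fix m
  have "mps_coeff (shift_hom cscale form \<alpha> \<nu> (series_conj (s_inf cscale form \<alpha>))) m =
    (\<Sum>\<tau> | \<tau> \<in> partition_families \<and> case_sum (size_vec \<tau>) (part_vec \<tau> 0) = m.
      qvar powi weight_pairing cscale form \<alpha> \<nu> (m \<circ> Inr) * qconj (inf_coeff \<tau>))"
    by (simp add: shift_hom_def Abs_mps_inverse series_conj_def mps_map.rep_eq s_inf_def
        inf_coeff_def[symmetric] mps_coeff_sum_monom finite_monomial_fibre_partition_families
        qconj_sum sum_distrib_left)
  also have "\<dots> = (\<Sum>\<tau> | \<tau> \<in> partition_families \<and> case_sum (size_vec \<tau>) (part_vec \<tau> 0) = m.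
      qvar powi weight_pairing cscale form \<alpha> \<nu> (part_vec \<tau> 0) * qconj (inf_coeff \<tau>))"
    \<comment> \<open>On the fibre over \<open>m\<close> the y-exponent \<open>m \<circ> Inr\<close>
      is the first part vector of \<open>\<tau>\<close>.\<close>
    by (rule sum.cong) (auto simp: comp_def)
  finally show "mps_coeff (shift_hom cscale form \<alpha> \<nu> (series_conj (s_inf cscale form \<alpha>))) m =
    mps_coeff (mps_sum (\<lambda>\<tau>. mps_monom
        (qvar powi weight_pairing cscale form \<alpha> \<nu> (part_vec \<tau> 0) * qconj (inf_coeff \<tau>))
        (case_sum (size_vec \<tau>) (part_vec \<tau> 0))) partition_families) m"
    by (simp add: mps_coeff_sum_monom finite_monomial_fibre_partition_families)
qed

text \<open>Exponents are additive under part-by-part sums. The pairs contributing to the product at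
  \<open>m\<close> can therefore be grouped by their sum \<open>\<tau>\<close>, and the group of
  \<open>\<tau>\<close> is \<open>partition_splits \<tau>\<close>.\<close>

lemma s_wt_factorization:
  assumes diag: "\<And>i. C i i = 2" and \<nu>: "\<nu> \<in> weight_lattice form \<alpha>"
  shows "s_wt cscale form \<alpha> \<nu> =
    s_inf cscale form \<alpha> * shift_hom cscale form \<alpha> \<nu> (series_conj (s_inf cscale form \<alpha>))"
proof (rule mps_eqI)
  fix m :: "'i + 'i \<Rightarrow> nat"
  define e where "e \<tau> = case_sum (size_vec \<tau>) (part_vec \<tau> 0)" for \<tau> :: "'i \<Rightarrow> nat \<Rightarrow> nat"
  define P where "P = {(\<sigma>, \<rho>). \<sigma> \<in> partition_families \<and> \<rho> \<in> partition_families \<and>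
    (\<forall>v. e \<sigma> v + e \<rho> v = m v)}"
  define add where "add p = (\<lambda>i k. fst p i k + snd p i k)"
    for p :: "('i \<Rightarrow> nat \<Rightarrow> nat) \<times> ('i \<Rightarrow> nat \<Rightarrow> nat)"
  define F where "F p = inf_coeff (fst p) *
    (qvar powi weight_pairing cscale form \<alpha> \<nu> (part_vec (snd p) 0) * qconj (inf_coeff (snd p)))"
    for p :: "('i \<Rightarrow> nat \<Rightarrow> nat) \<times> ('i \<Rightarrow> nat \<Rightarrow> nat)"
  have fin: "finite {\<tau> \<in> partition_families. e \<tau> = m'}" for m'
    unfolding e_def by (rule finite_monomial_fibre_partition_families)
  have finP: "finite P"
    unfolding P_def exponent_sum_fibre using fin by simp
  have e_add: "e (add (\<sigma>, \<rho>)) v = e \<sigma> v + e \<rho> v"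
    if "\<sigma> \<in> partition_families" "\<rho> \<in> partition_families" for \<sigma> \<rho> v
    using size_vec_add[OF that] by (cases v) (simp_all add: e_def add_def part_vec_def)
  have splits: "partition_splits \<tau> = {p \<in> P. add p = \<tau>}" if "e \<tau> = m" for \<tau>
  proof -
    have "(\<forall>i k. \<sigma> i k + \<rho> i k = \<tau> i k) \<longleftrightarrow> add (\<sigma>, \<rho>) = \<tau>" for \<sigma> \<rho>
      by (simp add: add_def fun_eq_iff)
    moreover have "e \<sigma> v + e \<rho> v = m v"
      if "\<sigma> \<in> partition_families" "\<rho> \<in> partition_families" "add (\<sigma>, \<rho>) = \<tau>" for \<sigma> \<rho> v
      using e_add[OF that(1,2), of v] \<open>e \<tau> = m\<close> that(3) by simp
    ultimately show ?thesis
      by (auto simp: partition_splits_def P_def)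
  qed
  have "mps_coeff (s_wt cscale form \<alpha> \<nu>) m = (\<Sum>\<tau> | \<tau> \<in> partition_families \<and> e \<tau> = m. wt_coeff \<nu> \<tau>)"
    using mps_coeff_sum_monom[OF fin]
    by (simp add: s_wt_def wt_coeff_def[symmetric] e_def[symmetric])
  also have "\<dots> = (\<Sum>\<tau> | \<tau> \<in> partition_families \<and> e \<tau> = m. \<Sum>p | p \<in> P \<and> add p = \<tau>. F p)"
    by (rule sum.cong[OF refl]) (simp add: wt_coeff_split[OF diag \<nu>] splits F_def case_prod_unfold)
  also have "\<dots> = (\<Sum>p\<in>P. F p)"
    \<comment> \<open>Grouping requires that \<open>add\<close> maps \<open>P\<close> into the
      families of exponent \<open>m\<close>.\<close>
    by (rule sum.group[OF finP fin])
      (use e_add in \<open>auto simp: P_def add_def fun_eq_iff intro!: partition_family_add\<close>)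
  also have "\<dots> = mps_coeff
      (s_inf cscale form \<alpha> * shift_hom cscale form \<alpha> \<nu> (series_conj (s_inf cscale form \<alpha>))) m"
    \<comment> \<open>This rewriting comes first, while \<open>s_inf\<close> is still folded inside
      \<open>shift_hom\<close>.\<close>
    unfolding shift_hom_conj_s_inf
    unfolding s_inf_def inf_coeff_def[symmetric] e_def[symmetric]
      mps_coeff_mult_sum_monom[OF fin fin] P_def F_def
    by (simp add: case_prod_unfold)
  finally show "mps_coeff (s_wt cscale form \<alpha> \<nu>) m = mps_coeff
      (s_inf cscale form \<alpha> * shift_hom cscale form \<alpha> \<nu> (series_conj (s_inf cscale form \<alpha>))) m" .
qed

end

theorem theorem7p4:
  fixes \<Gamma> :: "('i::finite, 'e) pre_digraph"
    and cscale :: "complex \<Rightarrow> 'h::ab_group_add \<Rightarrow> 'h"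
    and form :: "'h \<Rightarrow> 'h \<Rightarrow> complex"
    and \<alpha> :: "'i \<Rightarrow> 'h"
    and \<nu> :: 'h
  assumes "fin_digraph \<Gamma>"
    and "loopfree_digraph \<Gamma>"
    and "verts \<Gamma> = UNIV"
    and "realization cscale (cartan_matrix \<Gamma>) form \<alpha>"
    and "\<nu> \<in> weight_lattice form \<alpha>"
  shows "s_wt cscale form \<alpha> \<nu> =
    s_inf cscale form \<alpha> * shift_hom cscale form \<alpha> \<nu> (series_conj (s_inf cscale form \<alpha>))"
  \<comment> \<open>The remaining premise holds because \<open>cartan_matrix\<close> has diagonal 2
    by definition.\<close>
  using realization.s_wt_factorization[OF assms(4) _ assms(5)] by (simp add: cartan_matrix_def)

end
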